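(* For every initial inventory level $x\in\mathbb{Z}_+$, $$V^*(x)=\widetilde V^*(x)+A,\qquad A:=\mathbb{E}\Big[\int_0^T e^{-\delta u}c_3(u)\,dN_u\Big]\in\mathbb{R}_+,$$ where $V^*$ is the original optimal cost $$V^*(x)=\inf_{\pi\in\Pi}\mathbb{E}\Big[\sum_{k=0}^{\tau-1}e^{-\delta k}\big(c(\mu_k(X_k))+C(k,X_k+\mu_k(X_k))\big)+e^{-\delta\tau}S(\tau,X_\tau)\,\Big|\,X_0=x\Big]$$ and $\widetilde V^*$ is the reformulated optimal cost $$\widetilde V^*(x)=\inf_{\pi\in\Pi}\mathbb{E}\Big[\sum_{k=0}^{\tau-1}e^{-\delta k}\big(c(\mu_k(X_k))+\widetilde C(k,X_k+\mu_k(X_k))\big)+e^{-\delta\tau}\widetilde S(X_\tau)\,\Big|\,X_0=x\Big].$$ (The sums are zero if $\tau=0$.)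
   Context: Setting. $T$ is a non-negative integer, $\mathbb{T}=\{0,1,\dots,T\}$, $\mathbb{Z}_+=\{0,1,2,\dots\}$. $N=(N_t)_{t\in[0,T]}$ is a non-homogeneous Poisson process ($N_0=0$) with intensity $\lambda:[0,T]\to\mathbb{R}_+$, which is right-continuous with left limits, differentiable except at finitely many points, and non-increasing; $\Lambda(t)=\int_0^t\lambda(u)\,du$. Constants: $\bar c,K,c_1\in\mathbb{R}_+$, $c_4\in\mathbb{R}$ with $\bar c>-c_4$, $\delta\in[0,1]$. Functions $c_2,c_3:[0,T]\to\mathbb{R}_+$ with $c_2\ge c_3$, Borel measurable with $\int_0^T c_i(u)\lambda(u)\,du<\infty$ for $i=2,3$. Ordering cost: $c(m)=K+\bar c\,m$ for $m>0$, $c(0)=0$. Integrals $\int_a^b(\cdot)\,dN_u$ are over $(a,b]$. For $k\in\{0,\dots,T-1\}$, $x\in\mathbb{Z}_+$: $\sigma^k_x:=\inf\{u>k:N_u-N_k\ge x\}$ ($\inf\emptyset=\infty$), and $$H(k,x)=c_1\mathbb{E}\Big[\int_k^{k+1}e^{-\delta(u-k)}(x-(N_u-N_k))^+du\Big],\quad L(k,x)=\mathbb{E}\Big[\int_{(k+1)\wedge\sigma^k_x}^{k+1}e^{-\delta(u-k)}c_2(u)\,dN_u\Big],$$ $C(k,x)=H(k,x)+L(k,x)$. For $k\in\mathbb{T}$: $S(k,x)=c_4x+\mathbb{E}\big[\int_k^Te^{-\delta(u-k)}c_3(u)\,dN_u\big]$. Reformulated costs: $\widetilde S(x)=c_4x$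 and $$\widetilde C(k,x)=H(k,x)+\mathbb{E}\Big[\int_k^{k+1}e^{-\delta(u-k)}[c_2(u)-c_3(u)]\,dN_u\Big]-\mathbb{E}\Big[\int_k^{(k+1)\wedge\sigma^k_x}e^{-\delta(u-k)}c_2(u)\,dN_u\Big].$$ Policies. $\Pi$ is the set of all $\pi=(\tau,\mu_0,\mu_1,\dots,\mu_T)$, where $\tau:\Omega\to\mathbb{T}$ is a stopping time of the filtration generated by $N$ and each $\mu_k:\mathbb{Z}_+\to\mathbb{Z}_+$ is an ordering function. Under $\pi$, the inventory evolves as $X_0=x$, $X_{k+1}=\big(X_k+\mu_k(X_k)-(N_{k+1}-N_k)\big)^+$ for $k=0,\dots,T-1$. *)

theory Defs
  imports "HOL-Probability.Probability"
begin

text \<open>The horizon \<open>T\<close> is a natural number; demand is observed on the real interval \<open>{0..T}\<close> and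
  decision epochs are \<open>{0, \<dots>, T}\<close>. All functions of time are HOL functions on \<open>real\<close> of which only
  the values on \<open>{0..T}\<close> are ever used.\<close>

section \<open>Non-homogeneous Poisson demand\<close>

definition admissible_intensity :: "nat \<Rightarrow> (real \<Rightarrow> real) \<Rightarrow> bool" where
  "admissible_intensity T lam \<longleftrightarrow>
     (\<forall>t\<in>{0..real T}. 0 \<le> lam t) \<and>
     (\<forall>t\<in>{0..<real T}. (lam \<longlongrightarrow> lam t) (at_right t)) \<and>
     (\<forall>t\<in>{0<..real T}. \<exists>l. (lam \<longlongrightarrow> l) (at_left t)) \<and>
     (\<exists>F. finite F \<and> (\<forall>t\<in>{0..real T} - F. lam differentiable (at t within {0..real T}))) \<and>
     antimono_on {0..real T} lam"

definition cumulative_intensity :: "(real \<Rightarrow> real) \<Rightarrow> real \<Rightarrow> real" where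
  "cumulative_intensity lam t = (LINT u:{0..t}|lborel. lam u)"

text \<open>The Poisson law is written out because \<open>poisson_pmf\<close> is specified only for a strictly
  positive rate, whereas an increment of \<open>cumulative_intensity lam\<close> may vanish (then the
  formula gives the point mass at 0, as \<open>0 ^ 0 = 1\<close>).\<close>

definition nonhomogeneous_Poisson ::
    "'a measure \<Rightarrow> nat \<Rightarrow> (real \<Rightarrow> real) \<Rightarrow> (real \<Rightarrow> 'a \<Rightarrow> nat) \<Rightarrow> bool" where
  "nonhomogeneous_Poisson M T lam N \<longleftrightarrow>
     (\<forall>t\<in>{0..real T}. N t \<in> measurable M (count_space UNIV)) \<and>
     (\<forall>\<omega>\<in>space M. N 0 \<omega> = 0) \<and>
     (\<forall>\<omega>\<in>space M. mono_on {0..real T} (\<lambda>t. N t \<omega>)) \<and>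
     (\<forall>\<omega>\<in>space M. \<forall>t\<in>{0..<real T}. ((\<lambda>u. real (N u \<omega>)) \<longlongrightarrow> real (N t \<omega>)) (at_right t)) \<and>
     (\<forall>(n::nat) t. 0 \<le> t 0 \<and> mono_on {..n} t \<and> t n \<le> real T \<longrightarrow>
        prob_space.indep_vars M (\<lambda>_. count_space (UNIV :: nat set))
          (\<lambda>i \<omega>. N (t (Suc i)) \<omega> - N (t i) \<omega>) {..<n}) \<and>
     (\<forall>s t n. 0 \<le> s \<and> s \<le> t \<and> t \<le> real T \<longrightarrow>
        measure M {\<omega>\<in>space M. N t \<omega> - N s \<omega> = n} =
          (cumulative_intensity lam t - cumulative_intensity lam s) ^ n / fact n
          * exp (- (cumulative_intensity lam t - cumulative_intensity lam s)))"

text \<open>Pathwise Lebesgue--Stieltjes integral of \<open>f\<close> against \<open>dN\<^sub>u\<close> over \<open>{a<..b}\<close>. As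
  \<open>interval_measure\<close> needs an integrator on all of \<open>real\<close>, each path is extended from \<open>{0..T}\<close> by
  its end values; this adds no mass outside \<open>{0<..T}\<close>.\<close>

definition stieltjes_int ::
    "nat \<Rightarrow> (real \<Rightarrow> 'a \<Rightarrow> nat) \<Rightarrow> 'a \<Rightarrow> real \<Rightarrow> real \<Rightarrow> (real \<Rightarrow> real) \<Rightarrow> real" where
  "stieltjes_int T N \<omega> a b f =
     (LINT u:{a<..b}|interval_measure (\<lambda>u. real (N (max 0 (min (real T) u)) \<omega>)). f u)"

definition natural_filtration ::
    "'a measure \<Rightarrow> nat \<Rightarrow> (real \<Rightarrow> 'a \<Rightarrow> nat) \<Rightarrow> real \<Rightarrow> 'a measure" where
  "natural_filtration M T N t =
     sigma (space M) {N s -` B \<inter> space M | s B. 0 \<le> s \<and> s \<le> t \<and> s \<le> real T}"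

section \<open>Cost functions\<close>

definition ordering_cost :: "real \<Rightarrow> real \<Rightarrow> nat \<Rightarrow> real" where
  "ordering_cost K cbar m = (if m = 0 then 0 else K + cbar * real m)"

text \<open>Extended-real valued, so that the infimum of the empty set is \<open>\<infinity>\<close>.\<close>

definition depletion_time ::
    "nat \<Rightarrow> (real \<Rightarrow> 'a \<Rightarrow> nat) \<Rightarrow> nat \<Rightarrow> nat \<Rightarrow> 'a \<Rightarrow> ereal" where
  "depletion_time T N k x \<omega> =
     Inf (ereal ` {u. real k < u \<and> u \<le> real T \<and> N u \<omega> - N (real k) \<omega> \<ge> x})"

definition stopped_epoch ::
    "nat \<Rightarrow> (real \<Rightarrow> 'a \<Rightarrow> nat) \<Rightarrow> nat \<Rightarrow> nat \<Rightarrow> 'a \<Rightarrow> real" where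
  "stopped_epoch T N k x \<omega> = real_of_ereal (min (ereal (real k + 1)) (depletion_time T N k x \<omega>))"

definition holding_cost ::
    "'a measure \<Rightarrow> (real \<Rightarrow> 'a \<Rightarrow> nat) \<Rightarrow> real \<Rightarrow> real \<Rightarrow> nat \<Rightarrow> nat \<Rightarrow> real" where
  "holding_cost M N \<delta> c1 k x =
     c1 * (\<integral>\<omega>. (LINT u:{real k..real k + 1}|lborel.
        exp (- \<delta> * (u - real k)) * max 0 (real x - (real (N u \<omega>) - real (N (real k) \<omega>)))) \<partial>M)"

definition lost_sales_cost ::
    "'a measure \<Rightarrow> nat \<Rightarrow> (real \<Rightarrow> 'a \<Rightarrow> nat) \<Rightarrow> real \<Rightarrow> (real \<Rightarrow> real) \<Rightarrow> nat \<Rightarrow> nat \<Rightarrow> real" where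
  "lost_sales_cost M T N \<delta> c2 k x =
     (\<integral>\<omega>. stieltjes_int T N \<omega> (stopped_epoch T N k x \<omega>) (real k + 1)
        (\<lambda>u. exp (- \<delta> * (u - real k)) * c2 u) \<partial>M)"

definition stage_cost ::
    "'a measure \<Rightarrow> nat \<Rightarrow> (real \<Rightarrow> 'a \<Rightarrow> nat) \<Rightarrow> real \<Rightarrow> real \<Rightarrow> (real \<Rightarrow> real) \<Rightarrow> nat \<Rightarrow> nat \<Rightarrow> real"
  where
  "stage_cost M T N \<delta> c1 c2 k x = holding_cost M N \<delta> c1 k x + lost_sales_cost M T N \<delta> c2 k x"

definition stopping_cost ::
    "'a measure \<Rightarrow> nat \<Rightarrow> (real \<Rightarrow> 'a \<Rightarrow> nat) \<Rightarrow> real \<Rightarrow> (real \<Rightarrow> real) \<Rightarrow> real \<Rightarrow> nat \<Rightarrow> nat \<Rightarrow> real"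
  where
  "stopping_cost M T N \<delta> c3 c4 k x =
     c4 * real x + (\<integral>\<omega>. stieltjes_int T N \<omega> (real k) (real T)
        (\<lambda>u. exp (- \<delta> * (u - real k)) * c3 u) \<partial>M)"

definition reformulated_stage_cost ::
    "'a measure \<Rightarrow> nat \<Rightarrow> (real \<Rightarrow> 'a \<Rightarrow> nat) \<Rightarrow> real \<Rightarrow> real \<Rightarrow> (real \<Rightarrow> real) \<Rightarrow> (real \<Rightarrow> real)
      \<Rightarrow> nat \<Rightarrow> nat \<Rightarrow> real" where
  "reformulated_stage_cost M T N \<delta> c1 c2 c3 k x =
     holding_cost M N \<delta> c1 k x
     + (\<integral>\<omega>. stieltjes_int T N \<omega> (real k) (real k + 1)
          (\<lambda>u. exp (- \<delta> * (u - real k)) * (c2 u - c3 u)) \<partial>M)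
     - (\<integral>\<omega>. stieltjes_int T N \<omega> (real k) (stopped_epoch T N k x \<omega>)
          (\<lambda>u. exp (- \<delta> * (u - real k)) * c2 u) \<partial>M)"

definition reformulated_stopping_cost :: "real \<Rightarrow> nat \<Rightarrow> real" where
  "reformulated_stopping_cost c4 x = c4 * real x"

section \<open>Policies and optimal cost\<close>

text \<open>A policy \<open>(\<tau>, \<mu>)\<close> has ordering functions \<open>\<mu> 0, \<dots>, \<mu> T\<close>; the values \<open>\<mu> k\<close> for \<open>k > T\<close> never
  enter the dynamics up to time \<open>T\<close> or the cost.\<close>

definition policies ::
    "'a measure \<Rightarrow> nat \<Rightarrow> (real \<Rightarrow> 'a \<Rightarrow> nat) \<Rightarrow> (('a \<Rightarrow> nat) \<times> (nat \<Rightarrow> nat \<Rightarrow> nat)) set" where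
  "policies M T N =
     {(\<tau>, \<mu>). (\<forall>\<omega>\<in>space M. \<tau> \<omega> \<le> T) \<and>
              stopping_time (natural_filtration M T N) (\<lambda>\<omega>. real (\<tau> \<omega>))}"

text \<open>Truncated subtraction on \<open>nat\<close> is the positive part in the inventory recursion.\<close>

primrec inventory ::
    "(real \<Rightarrow> 'a \<Rightarrow> nat) \<Rightarrow> (nat \<Rightarrow> nat \<Rightarrow> nat) \<Rightarrow> nat \<Rightarrow> nat \<Rightarrow> 'a \<Rightarrow> nat" where
  "inventory N \<mu> x 0 \<omega> = x"
| "inventory N \<mu> x (Suc k) \<omega> =
     (inventory N \<mu> x k \<omega> + \<mu> k (inventory N \<mu> x k \<omega>))
     - (N (real (Suc k)) \<omega> - N (real k) \<omega>)"

text \<open>Conditioning on \<open>X\<^sub>0 = x\<close> means starting the recursion at the deterministic level \<open>x\<close>.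
  \<open>C\<close> and \<open>S\<close> stand for an arbitrary stage cost and an arbitrary stopping cost.\<close>

definition policy_cost ::
    "'a measure \<Rightarrow> (real \<Rightarrow> 'a \<Rightarrow> nat) \<Rightarrow> real \<Rightarrow> (nat \<Rightarrow> real) \<Rightarrow> (nat \<Rightarrow> nat \<Rightarrow> real) \<Rightarrow> (nat \<Rightarrow> nat \<Rightarrow> real)
      \<Rightarrow> nat \<Rightarrow> ('a \<Rightarrow> nat) \<Rightarrow> (nat \<Rightarrow> nat \<Rightarrow> nat) \<Rightarrow> real" where
  "policy_cost M N \<delta> c C S x \<tau> \<mu> =
     (\<integral>\<omega>. (let X = (\<lambda>k. inventory N \<mu> x k \<omega>) in
            (\<Sum>k<\<tau> \<omega>. exp (- \<delta> * real k) * (c (\<mu> k (X k)) + C k (X k + \<mu> k (X k))))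
            + exp (- \<delta> * real (\<tau> \<omega>)) * S (\<tau> \<omega>) (X (\<tau> \<omega>))) \<partial>M)"

text \<open>The infimum is taken in the extended reals, where it needs no lower bound to be meaningful.\<close>

definition optimal_cost ::
    "'a measure \<Rightarrow> nat \<Rightarrow> (real \<Rightarrow> 'a \<Rightarrow> nat) \<Rightarrow> real \<Rightarrow> (nat \<Rightarrow> real) \<Rightarrow> (nat \<Rightarrow> nat \<Rightarrow> real)
      \<Rightarrow> (nat \<Rightarrow> nat \<Rightarrow> real) \<Rightarrow> nat \<Rightarrow> ereal" where
  "optimal_cost M T N \<delta> c C S x =
     (INF (\<tau>, \<mu>)\<in>policies M T N. ereal (policy_cost M N \<delta> c C S x \<tau> \<mu>))"

definition V_star where
  "V_star M T N \<delta> K cbar c1 c2 c3 c4 x =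
     optimal_cost M T N \<delta> (ordering_cost K cbar)
       (stage_cost M T N \<delta> c1 c2) (stopping_cost M T N \<delta> c3 c4) x"

definition V_tilde_star where
  "V_tilde_star M T N \<delta> K cbar c1 c2 c3 c4 x =
     optimal_cost M T N \<delta> (ordering_cost K cbar)
       (reformulated_stage_cost M T N \<delta> c1 c2 c3) (\<lambda>_. reformulated_stopping_cost c4) x"

definition discounted_c3 ::
    "nat \<Rightarrow> (real \<Rightarrow> 'a \<Rightarrow> nat) \<Rightarrow> real \<Rightarrow> (real \<Rightarrow> real) \<Rightarrow> 'a \<Rightarrow> real" where
  "discounted_c3 T N \<delta> c3 \<omega> = stieltjes_int T N \<omega> 0 (real T) (\<lambda>u. exp (- \<delta> * u) * c3 u)"

end

theory Submission
  imports Defs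
begin

text \<open>Discounted to time 0, the original and the reformulated stage cost of period \<open>k\<close> differ by the
  expected \<open>c\<^sub>3\<close>-cost of all demand in \<open>(k, k + 1]\<close>, whatever the stock level, and the stopping costs
  at \<open>k\<close> differ by the expected \<open>c\<^sub>3\<close>-cost of the demand after \<open>k\<close>. Along every path these
  deterministic differences telescope to \<open>A\<close>, independently of the policy. Splitting the expected
  costs needs integrability of the demand integrals, which is Campbell's formula
  \<open>E \<integral> f dN = \<integral> f \<lambda> du\<close>.\<close>

section \<open>Intensity and Poisson increments\<close>

text \<open>Demand lost in a period is all demand minus the demand before depletion. Writing
  \<open>c2\<close> as \<open>(c2 - c3) + c3\<close> in the first term isolates a part that does not
  see the stock, and this part is what the reformulated cost drops. The obstacle is analytic: a
  Bochner integral without integrability is 0, so each splitting needs integrability along almost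
  every path and over \<open>M\<close>, as well as measurability in \<omega> of an integral whose
  measure and whose endpoint at the depletion time are both random. The jump measures are therefore
  treated as a kernel. Its average over \<open>M\<close> agrees with \<open>lam u du\<close> on
  half-open intervals by the Poisson mean, hence on all Borel sets, and integrands over random
  windows are dominated by deterministic ones, to which Campbell's formula applies.\<close>

lemma antimono_on_Icc_set_integrable:
  fixes f :: "real \<Rightarrow> real"
  assumes anti: "antimono_on {a..b} f"
  shows "set_integrable lborel {a..b} f"
proof (cases "a \<le> b")
  case True
  have "mono_on {a..b} (\<lambda>u. - f u)"
    using anti by (auto simp: monotone_on_def)
  then have "(\<lambda>u. - f u) \<in> borel_measurable (restrict_space borel {a..b})"
    by (rule borel_measurable_mono_on_fnc)
  then have "(\<lambda>u. - (- f u)) \<in> borel_measurable (restrict_space borel {a..b})"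
    by (rule borel_measurable_uminus)
  then have meas: "(\<lambda>u. indicator {a..b} u *\<^sub>R f u) \<in> borel_measurable lborel"
    by (subst (asm) borel_measurable_restrict_space_iff) auto
  have "integrable lborel (\<lambda>u. indicator {a..b} u *\<^sub>R f u)"
  proof (rule Bochner_Integration.integrable_bound[OF _ meas])
    show "integrable lborel (\<lambda>u. indicator {a..b} u *\<^sub>R (max \<bar>f a\<bar> \<bar>f b\<bar>))"
      by (intro integrable_scaleR_left) (simp add: integrable_indicator_iff emeasure_lborel_Icc_eq)
    have "\<bar>f u\<bar> \<le> max \<bar>f a\<bar> \<bar>f b\<bar>" if "u \<in> {a..b}" for u
    proof -
      have "f b \<le> f u" "f u \<le> f a"
        using monotone_onD[OF anti, of u b] monotone_onD[OF anti, of a u] that by auto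
      then show ?thesis by linarith
    qed
    then show "AE u in lborel. norm (indicator {a..b} u *\<^sub>R f u)
        \<le> norm (indicator {a..b} u *\<^sub>R (max \<bar>f a\<bar> \<bar>f b\<bar>))"
      by (intro AE_I2) (auto simp: indicator_def)
  qed
  then show ?thesis
    unfolding set_integrable_def .
qed (simp add: set_integrable_def)

text \<open>The factor \<open>n\<close> cancels against the factorial, which leaves
  \<open>r * exp (- r)\<close> times the exponential series.\<close>

lemma Poisson_mean_sums:
  fixes r :: real
  shows "(\<lambda>n. real n * (r ^ n / fact n * exp (- r))) sums r"
proof -
  have "(\<lambda>n. r ^ n / fact n) sums exp r"
    using exp_converges[of r] by (simp add: divide_inverse mult.commute scaleR_conv_of_real)
  then have "(\<lambda>n. (r * exp (- r)) * (r ^ n / fact n)) sums ((r * exp (- r)) * exp r)"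
    by (rule sums_mult)
  also have "(\<lambda>n. (r * exp (- r)) * (r ^ n / fact n)) =
      (\<lambda>n. real (Suc n) * (r ^ Suc n / fact (Suc n) * exp (- r)))"
    by (rule ext) (simp add: field_simps del: of_nat_Suc)
  also have "(r * exp (- r)) * exp r = r"
    by (simp add: exp_minus)
  finally show ?thesis
    \<comment> \<open>Undoing the index shift adds the term at 0, which vanishes because of the
      factor \<open>n\<close>.\<close>
    by (subst (asm) sums_Suc_iff) simp
qed

text \<open>\<open>Z\<close> is summed over its level sets. Nonnegative integrals make the
  finiteness of the mean part of the conclusion.\<close>

lemma (in prob_space) nn_integral_Poisson:
  fixes Z :: "'a \<Rightarrow> nat"
  assumes Z [measurable]: "Z \<in> measurable M (count_space UNIV)" and "0 \<le> r"
    and law: "\<And>n. measure M {\<omega>\<in>space M. Z \<omega> = n} = r ^ n / fact n * exp (- r)"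
  shows "(\<integral>\<^sup>+\<omega>. ennreal (real (Z \<omega>)) \<partial>M) = ennreal r"
proof -
  have "(\<integral>\<^sup>+\<omega>. ennreal (real (Z \<omega>)) \<partial>M)
      = (\<integral>\<^sup>+\<omega>. (\<Sum>n. ennreal (real n) * indicator {\<omega>\<in>space M. Z \<omega> = n} \<omega>) \<partial>M)"
  proof (rule nn_integral_cong)
    fix \<omega> assume "\<omega> \<in> space M"
    then have "(\<lambda>n. ennreal (real n) * indicator {\<omega>\<in>space M. Z \<omega> = n} \<omega>)
        = (\<lambda>n. if n = Z \<omega> then ennreal (real (Z \<omega>)) else 0)"
      by (auto simp: fun_eq_iff)
    then have "(\<lambda>n. ennreal (real n) * indicator {\<omega>\<in>space M. Z \<omega> = n} \<omega>) sums ennreal (real (Z \<omega>))"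
      using sums_single[of "Z \<omega>" "\<lambda>_. ennreal (real (Z \<omega>))"] by simp
    then show "ennreal (real (Z \<omega>)) = (\<Sum>n. ennreal (real n) * indicator {\<omega>\<in>space M. Z \<omega> = n} \<omega>)"
      by (rule sums_unique)
  qed
  also have "\<dots> = (\<Sum>n. \<integral>\<^sup>+\<omega>. ennreal (real n) * indicator {\<omega>\<in>space M. Z \<omega> = n} \<omega> \<partial>M)"
    by (rule nn_integral_suminf) measurable
  also have "\<dots> = (\<Sum>n. ennreal (real n * (r ^ n / fact n * exp (- r))))"
  proof (rule suminf_cong)
    fix n
    have "(\<integral>\<^sup>+\<omega>. ennreal (real n) * indicator {\<omega>\<in>space M. Z \<omega> = n} \<omega> \<partial>M)
        = ennreal (real n) * emeasure M {\<omega>\<in>space M. Z \<omega> = n}"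
      by (rule nn_integral_cmult_indicator) measurable
    then show "(\<integral>\<^sup>+\<omega>. ennreal (real n) * indicator {\<omega>\<in>space M. Z \<omega> = n} \<omega> \<partial>M)
        = ennreal (real n * (r ^ n / fact n * exp (- r)))"
      using \<open>0 \<le> r\<close> by (simp add: emeasure_eq_measure law flip: ennreal_mult)
  qed
  also have "\<dots> = ennreal r"
    using Poisson_mean_sums[of r] \<open>0 \<le> r\<close>
    by (subst suminf_ennreal_eq[where x = r]) auto
  finally show ?thesis .
qed

text \<open>This generator of the Borel sets serves both for the measurability of the jump kernel
  and for the uniqueness of the mean measure. Disjoint intervals cause no exception, as
  \<open>{a<..b}\<close> is empty for \<open>b \<le> a\<close>.\<close>

lemma Int_stable_Ioc: "Int_stable (range (\<lambda>(a, b). {a<..b::real}))"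
proof (rule Int_stableI)
  fix A B :: "real set"
  assume "A \<in> range (\<lambda>(a, b). {a<..b})" "B \<in> range (\<lambda>(a, b). {a<..b})"
  then obtain a b c d where "A = {a<..b}" "B = {c<..d}" by auto
  then have "A \<inter> B = (\<lambda>(a, b). {a<..b}) (max a c, min b d)" by auto
  then show "A \<inter> B \<in> range (\<lambda>(a, b). {a<..b})" by (rule range_eqI)
qed

lemma integral_eq_add_AE:
  fixes f g h :: "'a \<Rightarrow> real"
  assumes "AE x in M. f x = g x + h x" "integrable M f" "integrable M g" "integrable M h"
  shows "(\<integral>x. f x \<partial>M) = (\<integral>x. g x \<partial>M) + (\<integral>x. h x \<partial>M)"
proof -
  have "(\<integral>x. f x \<partial>M) = (\<integral>x. g x + h x \<partial>M)"
    using assms by (intro integral_cong_AE) auto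
  then show ?thesis using assms by simp
qed

section \<open>The jump measure of a path and Campbell's formula\<close>

locale Poisson_demand = prob_space M for M :: "'a measure" +
  fixes T :: nat and N :: "real \<Rightarrow> 'a \<Rightarrow> nat" and lam :: "real \<Rightarrow> real"
  assumes admissible: "admissible_intensity T lam"
    and Poisson: "nonhomogeneous_Poisson M T lam N"
begin

definition path :: "'a \<Rightarrow> real \<Rightarrow> real" where
  "path \<omega> u = real (N (max 0 (min (real T) u)) \<omega>)"

definition jumps :: "'a \<Rightarrow> real measure" where
  "jumps \<omega> = interval_measure (path \<omega>)"

text \<open>The cut-off matters: outside \<open>{0..T}\<close> the function \<open>lam\<close> is
  arbitrary, possibly negative or not measurable.\<close>

definition rate :: "real \<Rightarrow> ennreal" where
  "rate u = ennreal (indicator {0..real T} u *\<^sub>R lam u)"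

lemma stieltjes_int_eq: "stieltjes_int T N \<omega> a b f = (LINT u:{a<..b}|jumps \<omega>. f u)"
  by (simp add: stieltjes_int_def jumps_def path_def[abs_def])

lemma sets_jumps [simp, measurable_cong]: "sets (jumps \<omega>) = sets borel"
  by (simp add: jumps_def)

lemma space_jumps [simp]: "space (jumps \<omega>) = UNIV"
  by (simp add: jumps_def)

lemma measurable_N [measurable]:
  "0 \<le> t \<Longrightarrow> t \<le> real T \<Longrightarrow> N t \<in> measurable M (count_space UNIV)"
  using Poisson by (auto simp: nonhomogeneous_Poisson_def)

lemma N_mono: "\<omega> \<in> space M \<Longrightarrow> 0 \<le> s \<Longrightarrow> s \<le> t \<Longrightarrow> t \<le> real T \<Longrightarrow> N s \<omega> \<le> N t \<omega>"
  using Poisson unfolding nonhomogeneous_Poisson_def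
  by (auto simp: monotone_on_def)

lemma path_mono: "\<omega> \<in> space M \<Longrightarrow> u \<le> v \<Longrightarrow> path \<omega> u \<le> path \<omega> v"
  unfolding path_def by (intro of_nat_mono N_mono) auto

lemma path_le_0: "\<omega> \<in> space M \<Longrightarrow> u \<le> 0 \<Longrightarrow> path \<omega> u = 0"
  using Poisson unfolding nonhomogeneous_Poisson_def path_def by (simp add: max.absorb1 min_le_iff_disj)

lemma path_ge_T: "real T \<le> u \<Longrightarrow> path \<omega> u = real (N (real T) \<omega>)"
  unfolding path_def by simp

text \<open>The formula for \<open>interval_measure\<close> on half-open intervals needs
  right-continuity on the whole line, so the two constant extensions have to be checked along with
  the process itself.\<close>

lemma path_right_continuous:
  assumes \<omega>: "\<omega> \<in> space M"
  shows "continuous (at_right t) (path \<omega>)"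
proof -
  consider "t < 0" | "0 \<le> t" "t < real T" | "real T \<le> t" by linarith
  then have "(path \<omega> \<longlongrightarrow> path \<omega> t) (at_right t)"
  proof cases
    case 1
    have "eventually (\<lambda>u. path \<omega> u = path \<omega> t) (at_right t)"
      using eventually_at_right_real[OF 1] by eventually_elim (use 1 path_le_0[OF \<omega>] in auto)
    then show ?thesis by (rule tendsto_eventually)
  next
    case 2
    have "((\<lambda>u. real (N u \<omega>)) \<longlongrightarrow> path \<omega> t) (at_right t)"
      using Poisson 2 \<omega> unfolding nonhomogeneous_Poisson_def path_def by simp
    moreover have "eventually (\<lambda>u. real (N u \<omega>) = path \<omega> u) (at_right t)"
      using eventually_at_right_real[OF 2(2)]
      by eventually_elim (use 2 in \<open>auto simp: path_def\<close>)
    ultimately show ?thesis by (rule Lim_transform_eventually)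
  next
    case 3
    have "eventually (\<lambda>u. path \<omega> u = path \<omega> t) (at_right t)"
      using eventually_at_right_less[of t] by eventually_elim (use 3 path_ge_T in auto)
    then show ?thesis by (rule tendsto_eventually)
  qed
  then show ?thesis by (simp add: continuous_within)
qed

lemma measurable_path [measurable]: "(\<lambda>\<omega>. path \<omega> u) \<in> borel_measurable M"
  unfolding path_def by measurable

lemma emeasure_jumps_Ioc:
  "\<omega> \<in> space M \<Longrightarrow> emeasure (jumps \<omega>) {a<..b} = (if a \<le> b then ennreal (path \<omega> b - path \<omega> a) else 0)"
  unfolding jumps_def
  by (subst emeasure_interval_measure_Ioc_eq) (auto intro: path_mono path_right_continuous)

lemma emeasure_jumps_UNIV:
  assumes \<omega>: "\<omega> \<in> space M"
  shows "emeasure (jumps \<omega>) UNIV = ennreal (path \<omega> (real T))"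
  unfolding jumps_def
proof (rule interval_measure_UNIV)
  show "(path \<omega> \<longlongrightarrow> 0) at_bot"
    by (rule tendsto_eventually, rule eventually_at_bot_linorderI[of 0]) (use path_le_0[OF \<omega>] in auto)
  show "(path \<omega> \<longlongrightarrow> path \<omega> (real T)) at_top"
    by (rule tendsto_eventually, rule eventually_at_top_linorderI[of "real T"]) (simp add: path_ge_T)
qed (use path_mono[OF \<omega>] path_right_continuous[OF \<omega>] in \<open>auto simp: path_def\<close>)

section \<open>The jump measures as a measurable kernel\<close>

definition mass :: "'a \<Rightarrow> real" where
  "mass \<omega> = 1 + path \<omega> (real T)"

definition weight :: "'a \<Rightarrow> ennreal" where
  "weight \<omega> = ennreal (inverse (mass \<omega>))"

lemma mass_pos: "0 < mass \<omega>"
  by (simp add: mass_def path_def add_pos_nonneg)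

lemma measurable_mass [measurable]: "mass \<in> borel_measurable M"
  unfolding mass_def by measurable

text \<open>The summand 1 in \<open>mass\<close> keeps it positive on paths without demand, so the
  normalisation can always be undone, even for infinite \<open>x\<close>.\<close>

lemma weight_cancel: "ennreal (mass \<omega>) * (weight \<omega> * x) = x"
proof -
  have "ennreal (mass \<omega>) * weight \<omega> = 1"
    unfolding weight_def using mass_pos[of \<omega>] by (simp flip: ennreal_mult)
  then show ?thesis by (simp add: mult.assoc[symmetric])
qed

text \<open>The Giry monad only knows kernels of mass at most 1, hence the normalisation.\<close>

lemma measurable_scaled_jumps [measurable]:
  "(\<lambda>\<omega>. scale_measure (weight \<omega>) (jumps \<omega>)) \<in> measurable M (subprob_algebra borel)"
proof (rule measurable_subprob_algebra_generated)
  show "sets borel = sigma_sets (UNIV :: real set) (range (\<lambda>(a, b). {a<..b::real}))"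
    by (subst borel_sigma_sets_Ioc) simp
  show "Int_stable (range (\<lambda>(a, b). {a<..b::real}))"
    by (rule Int_stable_Ioc)
  have [measurable]: "weight \<in> borel_measurable M"
    unfolding weight_def by measurable
  have UNIV: "emeasure (scale_measure (weight \<omega>) (jumps \<omega>)) UNIV
      = weight \<omega> * ennreal (path \<omega> (real T))" if "\<omega> \<in> space M" for \<omega>
    using that by (simp add: emeasure_jumps_UNIV)
  show "(\<lambda>\<omega>. emeasure (scale_measure (weight \<omega>) (jumps \<omega>)) UNIV) \<in> borel_measurable M"
    by (subst measurable_cong[OF UNIV]) measurable
  show "(\<lambda>\<omega>. emeasure (scale_measure (weight \<omega>) (jumps \<omega>)) A) \<in> borel_measurable M"
    if "A \<in> range (\<lambda>(a, b). {a<..b::real})" for A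
  proof -
    obtain a b where A: "A = {a<..b}" using that \<open>A \<in> _\<close> by auto
    have "emeasure (scale_measure (weight \<omega>) (jumps \<omega>)) A
        = weight \<omega> * (if a \<le> b then ennreal (path \<omega> b - path \<omega> a) else 0)" if "\<omega> \<in> space M" for \<omega>
      using that by (simp add: A emeasure_jumps_Ioc)
    then show ?thesis
      by (subst measurable_cong) measurable
  qed
  show "subprob_space (scale_measure (weight \<omega>) (jumps \<omega>))" if \<omega>: "\<omega> \<in> space M" for \<omega>
  proof (rule subprob_spaceI)
    have "weight \<omega> * ennreal (path \<omega> (real T)) \<le> weight \<omega> * ennreal (mass \<omega>)"
      by (intro mult_left_mono ennreal_leI) (auto simp: mass_def)
    also have "\<dots> = 1"
      using weight_cancel[of \<omega> 1] by (simp add: mult.commute)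
    finally have "weight \<omega> * ennreal (path \<omega> (real T)) \<le> 1" .
    then show "emeasure (scale_measure (weight \<omega>) (jumps \<omega>))
        (space (scale_measure (weight \<omega>) (jumps \<omega>))) \<le> 1"
      by (simp add: space_scale_measure emeasure_jumps_UNIV \<omega>)
  qed (simp add: space_scale_measure)
qed auto

lemma nn_integral_scaled_jumps:
  "f \<in> borel_measurable borel \<Longrightarrow>
    (\<integral>\<^sup>+u. f u \<partial>scale_measure (weight \<omega>) (jumps \<omega>)) = weight \<omega> * (\<integral>\<^sup>+u. f u \<partial>jumps \<omega>)"
  by (rule nn_integral_scale_measure) simp

text \<open>Measurability holds for the normalised kernel, and multiplying by \<open>mass\<close>
  restores the integral. The integrand may depend on \<omega>, which admits random integration
  windows.\<close>

lemma measurable_nn_integral_jumps [measurable (raw)]: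
  assumes h: "(\<lambda>(\<omega>, u). h \<omega> u) \<in> borel_measurable (M \<Otimes>\<^sub>M borel)"
  shows "(\<lambda>\<omega>. \<integral>\<^sup>+u. h \<omega> u \<partial>jumps \<omega>) \<in> borel_measurable M"
proof -
  have "(\<lambda>\<omega>. ennreal (mass \<omega>) * (\<integral>\<^sup>+u. h \<omega> u \<partial>scale_measure (weight \<omega>) (jumps \<omega>)))
      \<in> borel_measurable M"
    using nn_integral_measurable_subprob_algebra2[OF h measurable_scaled_jumps] by measurable
  moreover have "ennreal (mass \<omega>) * (\<integral>\<^sup>+u. h \<omega> u \<partial>scale_measure (weight \<omega>) (jumps \<omega>))
      = (\<integral>\<^sup>+u. h \<omega> u \<partial>jumps \<omega>)" if "\<omega> \<in> space M" for \<omega>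
  proof -
    have "h \<omega> \<in> borel_measurable borel"
      using measurable_compose[OF measurable_Pair1'[OF that] h] by simp
    then show ?thesis by (simp add: nn_integral_scaled_jumps weight_cancel)
  qed
  ultimately show ?thesis
    by (subst (asm) measurable_cong) auto
qed

section \<open>The expected jump measure and the intensity\<close>

lemma lam_nonneg: "u \<in> {0..real T} \<Longrightarrow> 0 \<le> lam u"
  using admissible by (auto simp: admissible_intensity_def)

lemma lam_set_integrable: "set_integrable lborel {0..real T} lam"
  using admissible by (intro antimono_on_Icc_set_integrable) (auto simp: admissible_intensity_def)

lemma measurable_rate [measurable]: "rate \<in> borel_measurable borel"
  using borel_measurable_integrable[OF lam_set_integrable[unfolded set_integrable_def]]
  unfolding rate_def by simp

lemma cumulative_intensity_diff:
  assumes "0 \<le> s" "s \<le> t" "t \<le> real T"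
  shows "cumulative_intensity lam t - cumulative_intensity lam s = (LINT u:{s<..t}|lborel. lam u)"
proof -
  have "{0..t} = {0..s} \<union> {s<..t}" using assms by auto
  moreover have "(LINT u:{0..s} \<union> {s<..t}|lborel. lam u)
      = (LINT u:{0..s}|lborel. lam u) + (LINT u:{s<..t}|lborel. lam u)"
    using assms by (intro set_integral_Un set_integrable_subset[OF lam_set_integrable]) auto
  ultimately show ?thesis by (simp add: cumulative_intensity_def)
qed

lemma nn_integral_rate_Ioc:
  assumes "0 \<le> s" "s \<le> t" "t \<le> real T"
  shows "(\<integral>\<^sup>+u. rate u * indicator {s<..t} u \<partial>lborel)
    = ennreal (cumulative_intensity lam t - cumulative_intensity lam s)"
proof -
  have "(\<integral>\<^sup>+u. rate u * indicator {s<..t} u \<partial>lborel)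
      = (\<integral>\<^sup>+u. ennreal (indicator {s<..t} u *\<^sub>R lam u) \<partial>lborel)"
    using assms by (intro nn_integral_cong) (auto simp: rate_def indicator_def)
  also have "\<dots> = ennreal (LINT u:{s<..t}|lborel. lam u)"
    unfolding set_lebesgue_integral_def
  proof (rule nn_integral_eq_integral)
    have "set_integrable lborel {s<..t} lam"
      using assms by (intro set_integrable_subset[OF lam_set_integrable]) auto
    then show "integrable lborel (\<lambda>u. indicator {s<..t} u *\<^sub>R lam u)"
      unfolding set_integrable_def .
    show "AE u in lborel. 0 \<le> indicator {s<..t} u *\<^sub>R lam u"
      using assms lam_nonneg by (intro AE_I2) (auto simp: indicator_def)
  qed
  finally show ?thesis by (simp add: cumulative_intensity_diff assms)
qed

lemma cumulative_intensity_mono: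
  assumes "0 \<le> s" "s \<le> t" "t \<le> real T"
  shows "cumulative_intensity lam s \<le> cumulative_intensity lam t"
proof -
  have "0 \<le> (LINT u:{s<..t}|lborel. lam u)"
    unfolding set_lebesgue_integral_def
    using assms lam_nonneg by (intro integral_nonneg_AE AE_I2) (auto simp: indicator_def)
  then show ?thesis using cumulative_intensity_diff[OF assms] by simp
qed

lemma nn_integral_increment:
  assumes "0 \<le> s" "s \<le> t" "t \<le> real T"
  shows "(\<integral>\<^sup>+\<omega>. ennreal (real (N t \<omega> - N s \<omega>)) \<partial>M)
    = ennreal (cumulative_intensity lam t - cumulative_intensity lam s)"
proof (rule nn_integral_Poisson)
  have [measurable]: "N t \<in> measurable M (count_space UNIV)" "N s \<in> measurable M (count_space UNIV)"
    using assms by auto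
  show "(\<lambda>\<omega>. N t \<omega> - N s \<omega>) \<in> measurable M (count_space UNIV)"
    by measurable
  show "0 \<le> cumulative_intensity lam t - cumulative_intensity lam s"
    using cumulative_intensity_mono[OF assms] by simp
  show "measure M {\<omega> \<in> space M. N t \<omega> - N s \<omega> = n} =
      (cumulative_intensity lam t - cumulative_intensity lam s) ^ n / fact n *
      exp (- (cumulative_intensity lam t - cumulative_intensity lam s))" for n
    using Poisson assms unfolding nonhomogeneous_Poisson_def by blast
qed

text \<open>Campbell's formula for the indicator of an interval: both sides are the increment of the
  cumulative intensity.\<close>

lemma nn_integral_jumps_Ioc:
  assumes "0 \<le> s" "s \<le> t" "t \<le> real T"
  shows "(\<integral>\<^sup>+\<omega>. emeasure (jumps \<omega>) {s<..t} \<partial>M) = (\<integral>\<^sup>+u. rate u * indicator {s<..t} u \<partial>lborel)"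
proof -
  have "(\<integral>\<^sup>+\<omega>. emeasure (jumps \<omega>) {s<..t} \<partial>M) = (\<integral>\<^sup>+\<omega>. ennreal (real (N t \<omega> - N s \<omega>)) \<partial>M)"
  proof (rule nn_integral_cong)
    fix \<omega> assume "\<omega> \<in> space M"
    then show "emeasure (jumps \<omega>) {s<..t} = ennreal (real (N t \<omega> - N s \<omega>))"
      using assms N_mono[of \<omega> s t] by (simp add: emeasure_jumps_Ioc path_def of_nat_diff)
  qed
  then show ?thesis
    by (simp add: nn_integral_increment nn_integral_rate_Ioc assms)
qed

text \<open>The mean measure of the point process, sending \<open>B\<close> to the expected number
  of jumps in \<open>B\<close>. The density \<open>mass\<close> put on \<open>M\<close> compensates
  the normalisation of the kernel.\<close>

definition mean_jumps :: "real measure" where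
  "mean_jumps = density M (\<lambda>\<omega>. ennreal (mass \<omega>))
     \<bind> (\<lambda>\<omega>. scale_measure (weight \<omega>) (jumps \<omega>))"

lemma nn_integral_mean_jumps:
  assumes f [measurable]: "f \<in> borel_measurable borel"
  shows "(\<integral>\<^sup>+u. f u \<partial>mean_jumps) = (\<integral>\<^sup>+\<omega>. \<integral>\<^sup>+u. f u \<partial>jumps \<omega> \<partial>M)"
proof -
  have "(\<integral>\<^sup>+u. f u \<partial>mean_jumps) = (\<integral>\<^sup>+\<omega>. \<integral>\<^sup>+u. f u \<partial>scale_measure (weight \<omega>) (jumps \<omega>)
      \<partial>density M (\<lambda>\<omega>. ennreal (mass \<omega>)))"
    unfolding mean_jumps_def by (rule nn_integral_bind[where B = borel]) auto
  also have "\<dots> = (\<integral>\<^sup>+\<omega>. ennreal (mass \<omega>) *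
      (\<integral>\<^sup>+u. f u \<partial>scale_measure (weight \<omega>) (jumps \<omega>)) \<partial>M)"
    by (rule nn_integral_density) (auto intro!: nn_integral_measurable_subprob_algebra2[where N = borel])
  finally show ?thesis
    by (simp add: nn_integral_scaled_jumps weight_cancel)
qed

lemma sets_mean_jumps [simp, measurable_cong]: "sets mean_jumps = sets borel"
  unfolding mean_jumps_def
  by (rule sets_bind[where N = borel]) (auto simp: not_empty)

text \<open>Two measures that agree on half-open intervals and are finite on an exhausting sequence
  of them are equal.\<close>

lemma mean_jumps_eq: "mean_jumps = density lborel rate"
proof (rule measure_eqI_generator_eq)
  let ?E = "range (\<lambda>(a, b). {a<..b::real})"
  show "Int_stable ?E" by (rule Int_stable_Ioc)
  show "sets mean_jumps = sigma_sets UNIV ?E" "sets (density lborel rate) = sigma_sets UNIV ?E"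
    by (simp_all, (subst borel_sigma_sets_Ioc, simp)+)
  have mean: "emeasure mean_jumps B = (\<integral>\<^sup>+\<omega>. emeasure (jumps \<omega>) B \<partial>M)" if "B \<in> sets borel" for B
    using nn_integral_mean_jumps[of "indicator B"] that by simp
  show eq: "emeasure mean_jumps X = emeasure (density lborel rate) X" if "X \<in> ?E" for X
  proof -
    obtain a b where X: "X = {a<..b}" using \<open>X \<in> ?E\<close> by auto
    show ?thesis
    proof (cases "a \<le> b")
      case True
      \<comment> \<open>The Poisson law covers only times in \<open>{0..T}\<close>. Clamping the
        endpoints loses no mass, since the path is constant outside and \<open>rate\<close> vanishes
        there.\<close>
      define s t where "s = max 0 (min (real T) a)" and "t = max 0 (min (real T) b)"
      have st: "0 \<le> s" "s \<le> t" "t \<le> real T" using True by (auto simp: s_def t_def)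
      have "emeasure mean_jumps X = (\<integral>\<^sup>+\<omega>. emeasure (jumps \<omega>) {s<..t} \<partial>M)"
        unfolding X by (subst mean) (use True st in \<open>auto intro!: nn_integral_cong simp: emeasure_jumps_Ioc path_def s_def t_def\<close>)
      also have "\<dots> = (\<integral>\<^sup>+u. rate u * indicator {s<..t} u \<partial>lborel)"
        by (rule nn_integral_jumps_Ioc[OF st])
      also have "\<dots> = (\<integral>\<^sup>+u. rate u * indicator X u \<partial>lborel)"
      proof (rule nn_integral_cong_AE)
        show "AE u in lborel. rate u * indicator {s<..t} u = rate u * indicator X u"
          \<comment> \<open>If \<open>a < 0 \<le> b\<close>, the point 0 lies in \<open>X\<close>
            but not in \<open>{s<..t}\<close>, and \<open>rate 0\<close> may be positive; it is a
            Lebesgue null set.\<close>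
          using AE_lborel_singleton[of 0]
          by eventually_elim (auto simp: X s_def t_def rate_def indicator_def)
      qed
      also have "\<dots> = emeasure (density lborel rate) X"
        by (rule emeasure_density[symmetric]) (auto simp: X)
      finally show ?thesis .
    qed (simp add: X)
  qed
  show "range (\<lambda>i::nat. {- real i<..real i}) \<subseteq> ?E" by auto
  show "(\<Union>i::nat. {- real i<..real i}) = UNIV" by (rule UN_Ioc_eq_UNIV)
  show "emeasure mean_jumps {- real i<..real i} \<noteq> \<infinity>" for i :: nat
  proof -
    have "emeasure mean_jumps {- real i<..real i} \<le> emeasure (density lborel rate) UNIV"
      by (subst eq) (auto intro!: emeasure_mono)
    also have "\<dots> = (\<integral>\<^sup>+u. ennreal (indicator {0..real T} u *\<^sub>R lam u) \<partial>lborel)"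
      by (subst emeasure_density) (auto simp: rate_def)
    also have "\<dots> \<le> (\<integral>\<^sup>+u. ennreal (norm (indicator {0..real T} u *\<^sub>R lam u)) \<partial>lborel)"
      by (intro nn_integral_mono ennreal_leI) auto
    also have "\<dots> < \<infinity>"
      using lam_set_integrable unfolding set_integrable_def integrable_iff_bounded by auto
    finally show ?thesis by simp
  qed
qed auto

lemma Campbell:
  assumes f [measurable]: "f \<in> borel_measurable borel"
  shows "(\<integral>\<^sup>+\<omega>. \<integral>\<^sup>+u. f u \<partial>jumps \<omega> \<partial>M) = (\<integral>\<^sup>+u. rate u * f u \<partial>lborel)"
  using nn_integral_mean_jumps[OF f] by (simp add: mean_jumps_eq nn_integral_density)


text \<open>Campbell's formula is for deterministic integrands, so the random \<open>h\<close> is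
  controlled through a deterministic majorant \<open>g\<close>. Finite expectation of the integral
  of \<open>g\<close> makes that integral finite on almost every path.\<close>

lemma
  fixes h :: "'a \<Rightarrow> real \<Rightarrow> real"
  assumes h: "(\<lambda>(\<omega>, u). h \<omega> u) \<in> borel_measurable (M \<Otimes>\<^sub>M borel)"
    and nonneg: "\<And>\<omega> u. \<omega> \<in> space M \<Longrightarrow> 0 \<le> h \<omega> u"
    and le: "\<And>\<omega> u. \<omega> \<in> space M \<Longrightarrow> h \<omega> u \<le> g u"
    and g [measurable]: "g \<in> borel_measurable borel"
    and fin: "(\<integral>\<^sup>+u. rate u * ennreal (g u) \<partial>lborel) < \<infinity>"
  shows AE_integrable_jumps: "AE \<omega> in M. integrable (jumps \<omega>) (h \<omega>)"
    and integrable_integral_jumps: "integrable M (\<lambda>\<omega>. \<integral>u. h \<omega> u \<partial>jumps \<omega>)"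
proof -
  have h_section: "h \<omega> \<in> borel_measurable borel" if "\<omega> \<in> space M" for \<omega>
    using measurable_compose[OF measurable_Pair1'[OF that] h] by simp
  have h_le: "(\<integral>\<^sup>+u. ennreal (h \<omega> u) \<partial>jumps \<omega>) \<le> (\<integral>\<^sup>+u. ennreal (g u) \<partial>jumps \<omega>)" if "\<omega> \<in> space M" for \<omega>
    using le[OF that] by (intro nn_integral_mono ennreal_leI)
  have fin': "(\<integral>\<^sup>+\<omega>. \<integral>\<^sup>+u. ennreal (g u) \<partial>jumps \<omega> \<partial>M) < \<infinity>"
    using fin by (subst Campbell) auto
  have "AE \<omega> in M. (\<integral>\<^sup>+u. ennreal (g u) \<partial>jumps \<omega>) \<noteq> \<infinity>"
    using fin' by (intro nn_integral_PInf_AE measurable_nn_integral_jumps) auto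
  then show "AE \<omega> in M. integrable (jumps \<omega>) (h \<omega>)"
    using AE_space
  proof eventually_elim
    case (elim \<omega>)
    show ?case
    proof (rule integrableI_nonneg)
      show "h \<omega> \<in> borel_measurable (jumps \<omega>)"
        using h_section[OF elim(2)] by simp
      show "AE u in jumps \<omega>. 0 \<le> h \<omega> u"
        using nonneg[OF elim(2)] by simp
      show "(\<integral>\<^sup>+u. ennreal (h \<omega> u) \<partial>jumps \<omega>) < \<infinity>"
        using h_le[OF elim(2)] elim(1) by (auto simp: less_top[symmetric] top_unique)
    qed
  qed
  \<comment> \<open>This holds on every path: where the right-hand integral is infinite, both sides
    are 0. Measurability in \<omega> thus follows from that of the nonnegative integral, with no
    exceptional null set.\<close>
  have eq: "(\<integral>u. h \<omega> u \<partial>jumps \<omega>) = enn2real (\<integral>\<^sup>+u. ennreal (h \<omega> u) \<partial>jumps \<omega>)" if "\<omega> \<in> space M" for \<omega>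
    using h_section[OF that] nonneg[OF that] by (intro integral_eq_nn_integral) auto
  have "(\<lambda>\<omega>. enn2real (\<integral>\<^sup>+u. ennreal (h \<omega> u) \<partial>jumps \<omega>)) \<in> borel_measurable M"
    using measurable_compose[OF h measurable_ennreal]
    by (intro borel_measurable_enn2real measurable_nn_integral_jumps) (simp add: case_prod_unfold)
  then have "integrable M (\<lambda>\<omega>. enn2real (\<integral>\<^sup>+u. ennreal (h \<omega> u) \<partial>jumps \<omega>))"
  proof (rule integrableI_nonneg)
    have "(\<integral>\<^sup>+\<omega>. ennreal (enn2real (\<integral>\<^sup>+u. ennreal (h \<omega> u) \<partial>jumps \<omega>)) \<partial>M)
        \<le> (\<integral>\<^sup>+\<omega>. \<integral>\<^sup>+u. ennreal (g u) \<partial>jumps \<omega> \<partial>M)"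
    proof (rule nn_integral_mono)
      fix \<omega> assume "\<omega> \<in> space M"
      have "ennreal (enn2real (\<integral>\<^sup>+u. ennreal (h \<omega> u) \<partial>jumps \<omega>)) \<le> (\<integral>\<^sup>+u. ennreal (h \<omega> u) \<partial>jumps \<omega>)"
        by (cases "(\<integral>\<^sup>+u. ennreal (h \<omega> u) \<partial>jumps \<omega>)") auto
      with h_le[OF \<open>\<omega> \<in> space M\<close>]
      show "ennreal (enn2real (\<integral>\<^sup>+u. ennreal (h \<omega> u) \<partial>jumps \<omega>)) \<le> (\<integral>\<^sup>+u. ennreal (g u) \<partial>jumps \<omega>)"
        by (rule order_trans[rotated])
    qed
    with fin' show "(\<integral>\<^sup>+\<omega>. ennreal (enn2real (\<integral>\<^sup>+u. ennreal (h \<omega> u) \<partial>jumps \<omega>)) \<partial>M) < \<infinity>"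
      by (rule order_le_less_trans[rotated])
  qed simp
  then show "integrable M (\<lambda>\<omega>. \<integral>u. h \<omega> u \<partial>jumps \<omega>)"
    by (rule Bochner_Integration.integrable_cong[THEN iffD1, rotated 2]) (auto simp: eq)
qed

section \<open>Discounted demand integrals between random times\<close>

definition cost_rate :: "(real \<Rightarrow> real) \<Rightarrow> bool" where
  "cost_rate f \<longleftrightarrow> f \<in> borel_measurable (restrict_space borel {0..real T}) \<and>
     (\<forall>u\<in>{0..real T}. 0 \<le> f u) \<and> set_integrable lborel {0..real T} (\<lambda>u. f u * lam u)"

text \<open>The random window is moved into the integrand, which turns this into the dominated case
  above with a multiple of \<open>f\<close> as majorant.\<close>

lemma
  fixes \<delta> :: real
  assumes f: "cost_rate f"
    and l [measurable]: "l \<in> borel_measurable M" and r [measurable]: "r \<in> borel_measurable M"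
    and l0: "\<And>\<omega>. \<omega> \<in> space M \<Longrightarrow> 0 \<le> l \<omega>" and rT: "\<And>\<omega>. \<omega> \<in> space M \<Longrightarrow> r \<omega> \<le> real T"
    and \<delta>: "0 \<le> \<delta>"
  shows AE_set_integrable_discounted:
      "AE \<omega> in M. set_integrable (jumps \<omega>) {l \<omega><..r \<omega>} (\<lambda>u. exp (- \<delta> * (u - real k)) * f u)"
    and integrable_stieltjes_int_discounted:
      "integrable M (\<lambda>\<omega>. stieltjes_int T N \<omega> (l \<omega>) (r \<omega>) (\<lambda>u. exp (- \<delta> * (u - real k)) * f u))"
proof -
  \<comment> \<open>\<open>f\<close> is controlled on \<open>{0..T}\<close> only; its extension by 0
    is Borel and nonnegative everywhere.\<close>
  define F where "F u = indicator {0..real T} u * f u" for u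
  define h where "h \<omega> u = (if l \<omega> < u \<and> u \<le> r \<omega> then exp (- \<delta> * (u - real k)) * F u else 0)" for \<omega> u
  \<comment> \<open>The constant is the discount factor at \<open>u = 0\<close>, its largest value
    for \<open>u \<ge> 0\<close>. Times before \<open>k\<close> are allowed, so 1 would not
    do.\<close>
  define g where "g u = exp (\<delta> * real k) * F u" for u
  have f_meas: "f \<in> borel_measurable (restrict_space borel {0..real T})"
    and f_nonneg: "\<And>u. u \<in> {0..real T} \<Longrightarrow> 0 \<le> f u"
    and f_int: "set_integrable lborel {0..real T} (\<lambda>u. f u * lam u)"
    using f by (auto simp: cost_rate_def)
  have F [measurable]: "F \<in> borel_measurable borel"
    using f_meas unfolding F_def by (subst (asm) borel_measurable_restrict_space_iff) auto
  have F_nonneg: "0 \<le> F u" for u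
    using f_nonneg by (auto simp: F_def indicator_def)
  have h_meas: "(\<lambda>(\<omega>, u). h \<omega> u) \<in> borel_measurable (M \<Otimes>\<^sub>M borel)"
    unfolding h_def by measurable
  have h_nonneg: "0 \<le> h \<omega> u" for \<omega> u
    using F_nonneg by (simp add: h_def)
  have h_le: "h \<omega> u \<le> g u" for \<omega> u
  proof (cases "0 \<le> u")
    case True
    then have "exp (- \<delta> * (u - real k)) \<le> exp (\<delta> * real k)"
      using \<delta> by (simp add: algebra_simps)
    then show ?thesis
      using F_nonneg[of u] by (auto simp: h_def g_def intro: mult_right_mono)
  qed (simp add: h_def g_def F_def)
  have g: "g \<in> borel_measurable borel"
    unfolding g_def by measurable
  have "(\<integral>\<^sup>+u. rate u * ennreal (g u) \<partial>lborel)
      = (\<integral>\<^sup>+u. ennreal (norm (exp (\<delta> * real k) * (indicator {0..real T} u *\<^sub>R (f u * lam u)))) \<partial>lborel)"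
    using lam_nonneg f_nonneg
    by (intro nn_integral_cong)
       (auto simp: rate_def g_def F_def indicator_def abs_mult mult_ac simp flip: ennreal_mult)
  also have "\<dots> < \<infinity>"
  proof -
    have "integrable lborel (\<lambda>u. exp (\<delta> * real k) * (indicator {0..real T} u *\<^sub>R (f u * lam u)))"
      using f_int unfolding set_integrable_def by (rule integrable_mult_right)
    then show ?thesis unfolding integrable_iff_bounded by auto
  qed
  finally have fin: "(\<integral>\<^sup>+u. rate u * ennreal (g u) \<partial>lborel) < \<infinity>" .
  have eq: "indicator {l \<omega><..r \<omega>} u *\<^sub>R (exp (- \<delta> * (u - real k)) * f u) = h \<omega> u"
    if "\<omega> \<in> space M" for \<omega> u
    using l0[OF that] rT[OF that] by (auto simp: h_def F_def indicator_def)
  show "AE \<omega> in M. set_integrable (jumps \<omega>) {l \<omega><..r \<omega>} (\<lambda>u. exp (- \<delta> * (u - real k)) * f u)"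
    using AE_integrable_jumps[OF h_meas h_nonneg h_le g fin] AE_space
    by eventually_elim (simp only: set_integrable_def eq)
  have "stieltjes_int T N \<omega> (l \<omega>) (r \<omega>) (\<lambda>u. exp (- \<delta> * (u - real k)) * f u) = (\<integral>u. h \<omega> u \<partial>jumps \<omega>)"
    if "\<omega> \<in> space M" for \<omega>
    unfolding stieltjes_int_eq set_lebesgue_integral_def using eq[OF that] by simp
  then show "integrable M (\<lambda>\<omega>. stieltjes_int T N \<omega> (l \<omega>) (r \<omega>) (\<lambda>u. exp (- \<delta> * (u - real k)) * f u))"
    using integrable_integral_jumps[OF h_meas h_nonneg h_le g fin]
    by (subst Bochner_Integration.integrable_cong[OF refl]) auto
qed

text \<open>Endpoints are functions of \<omega>, so that fixed epochs and the depletion time are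
  handled alike; \<open>k\<close> is the epoch to which costs are discounted.\<close>

definition mean_discounted :: "real \<Rightarrow> nat \<Rightarrow> ('a \<Rightarrow> real) \<Rightarrow> ('a \<Rightarrow> real) \<Rightarrow> (real \<Rightarrow> real) \<Rightarrow> real" where
  "mean_discounted \<delta> k l r f =
     (\<integral>\<omega>. stieltjes_int T N \<omega> (l \<omega>) (r \<omega>) (\<lambda>u. exp (- \<delta> * (u - real k)) * f u) \<partial>M)"

lemma mean_discounted_split:
  assumes f: "cost_rate f" and \<delta>: "0 \<le> \<delta>"
    and [measurable]: "l \<in> borel_measurable M" "m \<in> borel_measurable M" "r \<in> borel_measurable M"
    and ord: "\<And>\<omega>. \<omega> \<in> space M \<Longrightarrow> 0 \<le> l \<omega> \<and> l \<omega> \<le> m \<omega> \<and> m \<omega> \<le> r \<omega> \<and> r \<omega> \<le> real T"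
  shows "mean_discounted \<delta> k l r f = mean_discounted \<delta> k l m f + mean_discounted \<delta> k m r f"
proof -
  let ?f = "\<lambda>u. exp (- \<delta> * (u - real k)) * f u"
  have l0: "0 \<le> l \<omega>" and m0: "0 \<le> m \<omega>" and mT: "m \<omega> \<le> real T" and rT: "r \<omega> \<le> real T"
    if "\<omega> \<in> space M" for \<omega>
    using ord[OF that] by auto
  have AE_lm: "AE \<omega> in M. set_integrable (jumps \<omega>) {l \<omega><..m \<omega>} ?f"
    and AE_mr: "AE \<omega> in M. set_integrable (jumps \<omega>) {m \<omega><..r \<omega>} ?f"
    by (intro AE_set_integrable_discounted f \<delta> l0 m0 mT rT; simp)+
  have "AE \<omega> in M. stieltjes_int T N \<omega> (l \<omega>) (r \<omega>) ?f
      = stieltjes_int T N \<omega> (l \<omega>) (m \<omega>) ?f + stieltjes_int T N \<omega> (m \<omega>) (r \<omega>) ?f"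
    using AE_lm
      AE_mr AE_space
  proof eventually_elim
    case (elim \<omega>)
    have "{l \<omega><..r \<omega>} = {l \<omega><..m \<omega>} \<union> {m \<omega><..r \<omega>}"
      using ord[OF elim(3)] by auto
    then show ?case
      unfolding stieltjes_int_eq by (simp only:) (rule set_integral_Un[OF _ elim(1,2)], auto)
  qed
  moreover have "integrable M (\<lambda>\<omega>. stieltjes_int T N \<omega> (l \<omega>) (r \<omega>) ?f)"
    "integrable M (\<lambda>\<omega>. stieltjes_int T N \<omega> (l \<omega>) (m \<omega>) ?f)"
    "integrable M (\<lambda>\<omega>. stieltjes_int T N \<omega> (m \<omega>) (r \<omega>) ?f)"
    by (intro integrable_stieltjes_int_discounted f \<delta> l0 m0 mT rT; simp)+
  ultimately show ?thesis
    unfolding mean_discounted_def by (rule integral_eq_add_AE)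
qed

lemma mean_discounted_add:
  assumes f: "cost_rate f" and g: "cost_rate g" and fg: "cost_rate (\<lambda>u. f u + g u)" and \<delta>: "0 \<le> \<delta>"
    and lr: "0 \<le> l" "r \<le> real T"
  shows "mean_discounted \<delta> k (\<lambda>_. l) (\<lambda>_. r) (\<lambda>u. f u + g u)
    = mean_discounted \<delta> k (\<lambda>_. l) (\<lambda>_. r) f + mean_discounted \<delta> k (\<lambda>_. l) (\<lambda>_. r) g"
proof -
  let ?e = "\<lambda>f u. exp (- \<delta> * (u - real k)) * f u"
  have int: "integrable M (\<lambda>\<omega>. stieltjes_int T N \<omega> l r (?e f))" if "cost_rate f" for f
    using lr by (intro integrable_stieltjes_int_discounted that \<delta>) auto
  have ae: "AE \<omega> in M. set_integrable (jumps \<omega>) {l<..r} (?e f)" if "cost_rate f" for f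
    using lr by (intro AE_set_integrable_discounted[where l = "\<lambda>_. l" and r = "\<lambda>_. r"] that \<delta>) auto
  from ae[OF f] ae[OF g]
  have "AE \<omega> in M. stieltjes_int T N \<omega> l r (?e (\<lambda>u. f u + g u))
      = stieltjes_int T N \<omega> l r (?e f) + stieltjes_int T N \<omega> l r (?e g)"
    by eventually_elim (simp only: stieltjes_int_eq distrib_left set_integral_add(2))
  then show ?thesis
    unfolding mean_discounted_def by (rule integral_eq_add_AE[OF _ int[OF fg] int[OF f] int[OF g]])
qed

section \<open>Cost differences\<close>

text \<open>The bounds \<open>k\<close> and \<open>k + 1\<close> exclude infinite values, so the
  conversion from \<open>ereal\<close> is faithful. The strict inequality avoids asking whether the
  infimum is attained.\<close>

lemma
  assumes k: "k < T"
  shows stopped_epoch_bounds: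
      "real k \<le> stopped_epoch T N k x \<omega>" "stopped_epoch T N k x \<omega> \<le> real k + 1"
    and stopped_epoch_less_iff:
      "stopped_epoch T N k x \<omega> < a \<longleftrightarrow> real k + 1 < a \<or>
        (\<exists>u. real k < u \<and> u \<le> real T \<and> N u \<omega> - N (real k) \<omega> \<ge> x \<and> u < a)"
proof -
  let ?m = "min (ereal (real k + 1)) (depletion_time T N k x \<omega>)"
  have lower: "ereal (real k) \<le> ?m"
    by (auto simp: depletion_time_def intro!: Inf_greatest)
  have upper: "?m \<le> ereal (real k + 1)"
    by simp
  have m: "?m = ereal (stopped_epoch T N k x \<omega>)"
    unfolding stopped_epoch_def using lower upper by (cases ?m) auto
  show "real k \<le> stopped_epoch T N k x \<omega>" "stopped_epoch T N k x \<omega> \<le> real k + 1"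
    using lower upper unfolding m by auto
  have "stopped_epoch T N k x \<omega> < a \<longleftrightarrow> ?m < ereal a"
    unfolding m by simp
  also have "\<dots> \<longleftrightarrow> real k + 1 < a \<or> depletion_time T N k x \<omega> < ereal a"
    by (auto simp: min_less_iff_disj)
  finally show "stopped_epoch T N k x \<omega> < a \<longleftrightarrow> real k + 1 < a \<or>
        (\<exists>u. real k < u \<and> u \<le> real T \<and> N u \<omega> - N (real k) \<omega> \<ge> x \<and> u < a)"
    by (auto simp: depletion_time_def Inf_less_iff)
qed

text \<open>Since demand is non-decreasing, a level reached before \<open>a\<close> is also reached
  at some rational time before \<open>a\<close>, so a countable union of events suffices.\<close>

lemma measurable_stopped_epoch:
  assumes k: "k < T"
  shows "stopped_epoch T N k x \<in> borel_measurable M"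
proof (subst borel_measurable_iff_less, rule allI)
  fix a
  show "{\<omega> \<in> space M. stopped_epoch T N k x \<omega> < a} \<in> sets M"
  proof (cases "real k + 1 < a")
    case False
    \<comment> \<open>This keeps all rational times below \<open>a\<close> inside the horizon, where
      \<open>N\<close> is measurable and monotone.\<close>
    with k have a: "a \<le> real T" by linarith
    have "{\<omega> \<in> space M. stopped_epoch T N k x \<omega> < a} =
        (\<Union>v\<in>\<rat> \<inter> {real k<..<a}. {\<omega> \<in> space M. N v \<omega> - N (real k) \<omega> \<ge> x})"
    proof (intro set_eqI iffI)
      fix \<omega> assume "\<omega> \<in> {\<omega> \<in> space M. stopped_epoch T N k x \<omega> < a}"
      then obtain u where \<omega>: "\<omega> \<in> space M"
        and u: "real k < u" "u < a" "x \<le> N u \<omega> - N (real k) \<omega>"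
        using False by (auto simp: stopped_epoch_less_iff[OF k])
      obtain v where v: "v \<in> \<rat>" "u < v" "v < a"
        using Rats_dense_in_real[OF u(2)] by auto
      have "N u \<omega> \<le> N v \<omega>"
        using u v a by (intro N_mono[OF \<omega>]) auto
      with u v \<omega> show "\<omega> \<in> (\<Union>v\<in>\<rat> \<inter> {real k<..<a}. {\<omega> \<in> space M. N v \<omega> - N (real k) \<omega> \<ge> x})"
        by (intro UN_I[of v]) auto
    next
      fix \<omega> assume "\<omega> \<in> (\<Union>v\<in>\<rat> \<inter> {real k<..<a}. {\<omega> \<in> space M. N v \<omega> - N (real k) \<omega> \<ge> x})"
      then show "\<omega> \<in> {\<omega> \<in> space M. stopped_epoch T N k x \<omega> < a}"
        using a by (auto simp: stopped_epoch_less_iff[OF k])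
    qed
    also have "\<dots> \<in> sets M"
    proof (rule sets.countable_UN'')
      show "countable (\<rat> \<inter> {real k<..<a})"
        by (rule countable_Int1[OF countable_rat])
      fix v assume "v \<in> \<rat> \<inter> {real k<..<a}"
      then have [measurable]: "N v \<in> measurable M (count_space UNIV)"
        "N (real k) \<in> measurable M (count_space UNIV)"
        using a k by (auto intro!: measurable_N)
      show "{\<omega> \<in> space M. x \<le> N v \<omega> - N (real k) \<omega>} \<in> sets M"
        by measurable
    qed
    finally show ?thesis .
  next
    case True
    then have "{\<omega> \<in> space M. stopped_epoch T N k x \<omega> < a} = space M"
      by (auto simp: stopped_epoch_less_iff[OF k])
    then show ?thesis by simp
  qed
qed

text \<open>The potential that telescopes. It is discounted to time 0 instead of \<open>k\<close>,
  so that differences of successive values carry no extra factor; for \<open>c3\<close> its value at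
  0 is \<open>A\<close>.\<close>

definition tail_cost :: "real \<Rightarrow> (real \<Rightarrow> real) \<Rightarrow> nat \<Rightarrow> real" where
  "tail_cost \<delta> f k = mean_discounted \<delta> 0 (\<lambda>_. real k) (\<lambda>_. real T) f"

text \<open>Constant factors pass through Bochner integrals unconditionally, so no assumption on
  \<open>l\<close>, \<open>r\<close> or \<open>f\<close> is made.\<close>

lemma mean_discounted_shift:
  "exp (- \<delta> * real k) * mean_discounted \<delta> k l r f = mean_discounted \<delta> 0 l r f"
proof -
  have "exp (- \<delta> * u) * f u = exp (- \<delta> * real k) * (exp (- \<delta> * (u - real k)) * f u)" for u
    by (simp add: exp_add[symmetric] mult.assoc[symmetric] algebra_simps)
  then have "mean_discounted \<delta> 0 l r f =
      (\<integral>\<omega>. exp (- \<delta> * real k) * stieltjes_int T N \<omega> (l \<omega>) (r \<omega>) (\<lambda>u. exp (- \<delta> * (u - real k)) * f u) \<partial>M)"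
    unfolding mean_discounted_def stieltjes_int_def of_nat_0 diff_0_right
    by (simp only: set_integral_mult_right)
  then show ?thesis
    by (simp add: mean_discounted_def)
qed

lemma stopping_cost_discounted:
  "exp (- \<delta> * real k) * stopping_cost M T N \<delta> f c4 k x
    = exp (- \<delta> * real k) * reformulated_stopping_cost c4 x + tail_cost \<delta> f k"
  unfolding tail_cost_def mean_discounted_shift[of \<delta> k, symmetric]
  by (simp add: stopping_cost_def reformulated_stopping_cost_def mean_discounted_def distrib_left)

lemma stage_cost_discounted:
  assumes k: "k < T" and \<delta>: "0 \<le> \<delta>"
    and c2: "cost_rate c2" and c3: "cost_rate c3" and diff: "cost_rate (\<lambda>u. c2 u - c3 u)"
  shows "exp (- \<delta> * real k) * stage_cost M T N \<delta> c1 c2 k x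
    = exp (- \<delta> * real k) * reformulated_stage_cost M T N \<delta> c1 c2 c3 k x
      + (tail_cost \<delta> c3 k - tail_cost \<delta> c3 (Suc k))"
proof -
  let ?J = "mean_discounted \<delta> k" and ?s = "stopped_epoch T N k x"
  let ?k = "\<lambda>_. real k" and ?k1 = "\<lambda>_. real k + 1"
  have kT: "real k + 1 \<le> real T" using k by linarith
  \<comment> \<open>The sum simplifies to \<open>c2\<close>. Splitting its integral at the depletion
    time as well, the part before depletion cancels against the term subtracted in the reformulated
    cost, and only \<open>c3\<close> on the whole period is left.\<close>
  have "?J ?k ?k1 (\<lambda>u. (c2 u - c3 u) + c3 u) = ?J ?k ?k1 (\<lambda>u. c2 u - c3 u) + ?J ?k ?k1 c3"
    using kT c2 by (intro mean_discounted_add diff c3 \<delta>) auto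
  moreover have "?J ?k ?k1 c2 = ?J ?k ?s c2 + ?J ?s ?k1 c2"
    using kT stopped_epoch_bounds[OF k] measurable_stopped_epoch[OF k]
    by (intro mean_discounted_split c2 \<delta>) auto
  ultimately have "stage_cost M T N \<delta> c1 c2 k x
      = reformulated_stage_cost M T N \<delta> c1 c2 c3 k x + ?J ?k ?k1 c3"
    by (simp add: stage_cost_def reformulated_stage_cost_def lost_sales_cost_def mean_discounted_def)
  moreover have "tail_cost \<delta> c3 k = mean_discounted \<delta> 0 ?k ?k1 c3 + tail_cost \<delta> c3 (Suc k)"
    unfolding tail_cost_def of_nat_Suc add.commute[of 1]
    using kT by (intro mean_discounted_split c3 \<delta>) auto
  ultimately show ?thesis
    by (simp only: distrib_left mean_discounted_shift)
qed

section \<open>Policies\<close>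

lemma measurable_inventory:
  "k \<le> T \<Longrightarrow> inventory N \<mu> x k \<in> measurable M (count_space UNIV)"
proof (induction k)
  case 0
  show ?case by (subst measurable_cong[where g = "\<lambda>_. x"]) auto
next
  case (Suc k)
  then have [measurable]: "inventory N \<mu> x k \<in> measurable M (count_space UNIV)"
    "N (real (Suc k)) \<in> measurable M (count_space UNIV)" "N (real k) \<in> measurable M (count_space UNIV)"
    by (auto intro!: measurable_N)
  have "(\<lambda>\<omega>. inventory N \<mu> x k \<omega> + \<mu> k (inventory N \<mu> x k \<omega>) - (N (real (Suc k)) \<omega> - N (real k) \<omega>))
      \<in> measurable M (count_space UNIV)"
    by measurable
  then show ?case by simp
qed

text \<open>Demand only lowers the stock. As \<open>\<mu> k\<close> is arbitrary, its values on the
  finitely many levels up to \<open>b\<close> are bounded by their sum.\<close>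

lemma inventory_bounded: "\<exists>b. \<forall>\<omega>. inventory N \<mu> x k \<omega> \<le> b"
proof (induction k)
  case (Suc k)
  then obtain b where b: "\<And>\<omega>. inventory N \<mu> x k \<omega> \<le> b" by blast
  have "inventory N \<mu> x (Suc k) \<omega> \<le> (\<Sum>i\<le>b. i + \<mu> k i)" for \<omega>
  proof -
    let ?i = "inventory N \<mu> x k \<omega>"
    have "inventory N \<mu> x (Suc k) \<omega> \<le> ?i + \<mu> k ?i" by simp
    also have "\<dots> \<le> (\<Sum>i\<le>b. i + \<mu> k i)"
      using b by (intro member_le_sum[of ?i _ "\<lambda>i. i + \<mu> k i"]) auto
    finally show ?thesis .
  qed
  then show ?case by blast
qed auto

text \<open>Each \<sigma>-algebra of the filtration is contained in that of
  \<open>M\<close>.\<close>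

lemma measurable_policy_time:
  assumes "(\<tau>, \<mu>) \<in> policies M T N"
  shows "\<tau> \<in> measurable M (count_space UNIV)"
proof -
  have sub: "sets (natural_filtration M T N t) \<subseteq> sets M" for t
  proof -
    have "{N s -` B \<inter> space M | s B. 0 \<le> s \<and> s \<le> t \<and> s \<le> real T} \<subseteq> sets M"
      by (auto intro!: measurable_sets[OF measurable_N])
    then show ?thesis
      unfolding natural_filtration_def
      by (subst sets_measure_of) (auto dest: sets.sets_into_space intro!: sets.sigma_sets_subset)
  qed
  have space: "space (natural_filtration M T N t) = space M" for t
    unfolding natural_filtration_def by (rule space_measure_of) auto
  have "{\<omega> \<in> space M. real (\<tau> \<omega>) \<le> a} \<in> sets M" for a
  proof -
    have "Measurable.pred (natural_filtration M T N a) (\<lambda>\<omega>. real (\<tau> \<omega>) \<le> a)"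
      using assms by (auto simp: policies_def stopping_time_def)
    then show ?thesis
      using sub[of a] by (auto simp: pred_def space)
  qed
  then have "(\<lambda>\<omega>. real (\<tau> \<omega>)) \<in> borel_measurable M"
    by (subst borel_measurable_iff_le) auto
  \<comment> \<open>The floor returns \<open>\<tau>\<close> itself and turns real-valued
    measurability into discrete measurability.\<close>
  then have "(\<lambda>\<omega>. nat \<lfloor>real (\<tau> \<omega>)\<rfloor>) \<in> measurable M (count_space UNIV)"
    by measurable
  then show ?thesis by simp
qed

text \<open>Starting from a deterministic level the inventory takes finitely many values, so policy costs
  are genuine expectations; for a non-integrable cost the Bochner integral would be the junk value 0,
  which is not shifted by \<open>A\<close>.\<close>

lemma integrable_inventory_on_event:
  assumes "k \<le> T" and P: "Measurable.pred M P"
  shows "integrable M (\<lambda>\<omega>. if P \<omega> then g (inventory N \<mu> x k \<omega>) else (0 :: real))"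
proof -
  obtain b where b: "\<And>\<omega>. inventory N \<mu> x k \<omega> \<le> b"
    using inventory_bounded by blast
  show ?thesis
  proof (rule integrable_const_bound)
    have "norm (if P \<omega> then g (inventory N \<mu> x k \<omega>) else 0) \<le> (\<Sum>i\<le>b. \<bar>g i\<bar>)" for \<omega>
      using b by (auto intro!: member_le_sum[of _ _ "\<lambda>i. \<bar>g i\<bar>"] sum_nonneg)
    then show "AE \<omega> in M. norm (if P \<omega> then g (inventory N \<mu> x k \<omega>) else 0) \<le> (\<Sum>i\<le>b. \<bar>g i\<bar>)"
      by simp
    have [measurable]: "(\<lambda>\<omega>. g (inventory N \<mu> x k \<omega>)) \<in> borel_measurable M"
      by (rule measurable_compose[OF measurable_inventory[OF \<open>k \<le> T\<close>]]) simp
    show "(\<lambda>\<omega>. if P \<omega> then g (inventory N \<mu> x k \<omega>) else 0) \<in> borel_measurable M"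
      using P by measurable
  qed
qed

text \<open>The random summation bound and the random stopping index are replaced by the events
  \<open>k < \<tau> \<omega>\<close> and \<open>\<tau> \<omega> = k\<close> for fixed
  \<open>k\<close>, which leaves finitely many bounded terms.\<close>

lemma integrable_policy_cost:
  assumes pol: "(\<tau>, \<mu>) \<in> policies M T N"
  shows "integrable M (\<lambda>\<omega>. (\<Sum>k<\<tau> \<omega>. g k (inventory N \<mu> x k \<omega>))
    + (s (\<tau> \<omega>) (inventory N \<mu> x (\<tau> \<omega>) \<omega>) :: real))"
proof -
  note [measurable] = measurable_policy_time[OF pol]
  have "integrable M (\<lambda>\<omega>. (\<Sum>k<T. if k < \<tau> \<omega> then g k (inventory N \<mu> x k \<omega>) else 0)
      + (\<Sum>k\<le>T. if \<tau> \<omega> = k then s k (inventory N \<mu> x k \<omega>) else 0))"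
    by (intro Bochner_Integration.integrable_add Bochner_Integration.integrable_sum
        integrable_inventory_on_event) (auto, measurable)
  moreover have "(\<Sum>k<T. if k < \<tau> \<omega> then g k (inventory N \<mu> x k \<omega>) else 0)
      + (\<Sum>k\<le>T. if \<tau> \<omega> = k then s k (inventory N \<mu> x k \<omega>) else 0)
    = (\<Sum>k<\<tau> \<omega>. g k (inventory N \<mu> x k \<omega>)) + s (\<tau> \<omega>) (inventory N \<mu> x (\<tau> \<omega>) \<omega>)"
    if "\<omega> \<in> space M" for \<omega>
  proof -
    have \<tau>: "\<tau> \<omega> \<le> T" using pol that by (auto simp: policies_def)
    then have "{..<T} \<inter> {k. k < \<tau> \<omega>} = {..<\<tau> \<omega>}" by auto
    then show ?thesis using \<tau> by (simp add: sum.If_cases)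
  qed
  ultimately show ?thesis
    by (subst (asm) Bochner_Integration.integrable_cong[OF refl]) auto
qed

lemma policy_cost_shift:
  assumes pol: "(\<tau>, \<mu>) \<in> policies M T N" and \<delta>: "0 \<le> \<delta>"
    and c2: "cost_rate c2" and c3: "cost_rate c3" and diff: "cost_rate (\<lambda>u. c2 u - c3 u)"
  shows "policy_cost M N \<delta> c (stage_cost M T N \<delta> c1 c2) (stopping_cost M T N \<delta> c3 c4) x \<tau> \<mu>
    = policy_cost M N \<delta> c (reformulated_stage_cost M T N \<delta> c1 c2 c3)
        (\<lambda>_. reformulated_stopping_cost c4) x \<tau> \<mu> + tail_cost \<delta> c3 0"
proof -
  define e where "e k = exp (- \<delta> * real k)" for k
  define B where "B = tail_cost \<delta> c3"
  define X where "X k \<omega> = inventory N \<mu> x k \<omega>" for k \<omega>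
  define C where "C k i = c (\<mu> k i) + reformulated_stage_cost M T N \<delta> c1 c2 c3 k (i + \<mu> k i)" for k i
  define Y where "Y \<omega> = (\<Sum>k<\<tau> \<omega>. e k * C k (X k \<omega>))
    + e (\<tau> \<omega>) * reformulated_stopping_cost c4 (X (\<tau> \<omega>) \<omega>)" for \<omega>
  have Y: "integrable M Y"
    unfolding Y_def X_def by (rule integrable_policy_cost[OF pol])
  have pathwise: "(\<Sum>k<\<tau> \<omega>. e k * (c (\<mu> k (X k \<omega>)) + stage_cost M T N \<delta> c1 c2 k (X k \<omega> + \<mu> k (X k \<omega>))))
      + e (\<tau> \<omega>) * stopping_cost M T N \<delta> c3 c4 (\<tau> \<omega>) (X (\<tau> \<omega>) \<omega>) = Y \<omega> + B 0"
    if "\<omega> \<in> space M" for \<omega>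
  proof -
    have \<tau>: "\<tau> \<omega> \<le> T" using pol that by (auto simp: policies_def)
    have "(\<Sum>k<\<tau> \<omega>. e k * (c (\<mu> k (X k \<omega>)) + stage_cost M T N \<delta> c1 c2 k (X k \<omega> + \<mu> k (X k \<omega>))))
        = (\<Sum>k<\<tau> \<omega>. e k * C k (X k \<omega>) + (B k - B (Suc k)))"
    proof (rule sum.cong[OF refl])
      fix k assume "k \<in> {..<\<tau> \<omega>}"
      then have "k < T" using \<tau> by simp
      then show "e k * (c (\<mu> k (X k \<omega>)) + stage_cost M T N \<delta> c1 c2 k (X k \<omega> + \<mu> k (X k \<omega>)))
          = e k * C k (X k \<omega>) + (B k - B (Suc k))"
        unfolding e_def B_def C_def distrib_left
        by (subst stage_cost_discounted[OF _ \<delta> c2 c3 diff]) auto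
    qed
    \<comment> \<open>The remaining \<open>B (\<tau> \<omega>)\<close> is restored by the stopping
      cost, so the stopping time drops out.\<close>
    also have "\<dots> = (\<Sum>k<\<tau> \<omega>. e k * C k (X k \<omega>)) + (B 0 - B (\<tau> \<omega>))"
      by (simp add: sum.distrib sum_lessThan_telescope')
    finally show ?thesis
      unfolding Y_def
      using stopping_cost_discounted[of \<delta> "\<tau> \<omega>" c3 c4 "X (\<tau> \<omega>) \<omega>"] by (simp add: e_def B_def)
  qed
  have "policy_cost M N \<delta> c (stage_cost M T N \<delta> c1 c2) (stopping_cost M T N \<delta> c3 c4) x \<tau> \<mu>
      = (\<integral>\<omega>. Y \<omega> + B 0 \<partial>M)"
    unfolding policy_cost_def Let_def
    by (intro Bochner_Integration.integral_cong refl) (use pathwise in \<open>simp add: X_def e_def\<close>)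
  also have "\<dots> = (\<integral>\<omega>. Y \<omega> \<partial>M) + B 0"
    using Y by (simp add: prob_space)
  finally show ?thesis
    by (simp add: policy_cost_def Let_def Y_def X_def C_def e_def B_def)
qed

end

text \<open>As \<open>c\<close> is finite, adding it can be undone by subtraction, even if the
  infimum is infinite or \<open>I\<close> is empty.\<close>

lemma INF_ereal_add_const:
  fixes f :: "'b \<Rightarrow> ereal"
  shows "(INF i\<in>I. f i + ereal c) = (INF i\<in>I. f i) + ereal c"
proof (rule antisym)
  have "(INF i\<in>I. f i + ereal c) - ereal c \<le> (INF i\<in>I. f i)"
    by (intro INF_greatest) (auto simp: ereal_minus_le intro: INF_lower)
  then show "(INF i\<in>I. f i + ereal c) \<le> (INF i\<in>I. f i) + ereal c"
    by (simp add: ereal_minus_le)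
  show "(INF i\<in>I. f i) + ereal c \<le> (INF i\<in>I. f i + ereal c)"
    by (intro INF_greatest add_right_mono INF_lower)
qed

theorem proposition3p1:
  fixes M :: "'a measure" and T :: nat and N :: "real \<Rightarrow> 'a \<Rightarrow> nat"
    and lam c2 c3 :: "real \<Rightarrow> real" and cbar K c1 c4 \<delta> :: real and x :: nat
  assumes "prob_space M"
    and "admissible_intensity T lam"
    and "nonhomogeneous_Poisson M T lam N"
    and "0 \<le> cbar" and "0 \<le> K" and "0 \<le> c1" and "- c4 < cbar"
    and "0 \<le> \<delta>" and "\<delta> \<le> 1"
    and "\<And>u. u \<in> {0..real T} \<Longrightarrow> 0 \<le> c3 u"
    and "\<And>u. u \<in> {0..real T} \<Longrightarrow> 0 \<le> c2 u"
    and "\<And>u. u \<in> {0..real T} \<Longrightarrow> c3 u \<le> c2 u"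
    and "c2 \<in> borel_measurable (restrict_space borel {0..real T})"
    and "c3 \<in> borel_measurable (restrict_space borel {0..real T})"
    and "set_integrable lborel {0..real T} (\<lambda>u. c2 u * lam u)"
    and "set_integrable lborel {0..real T} (\<lambda>u. c3 u * lam u)"
  defines "A \<equiv> (\<integral>\<omega>. discounted_c3 T N \<delta> c3 \<omega> \<partial>M)"
  shows "integrable M (discounted_c3 T N \<delta> c3) \<and> 0 \<le> A \<and>
         V_star M T N \<delta> K cbar c1 c2 c3 c4 x = V_tilde_star M T N \<delta> K cbar c1 c2 c3 c4 x + ereal A"
proof -
  interpret prob_space M by fact
  interpret Poisson_demand M T N lam
    by unfold_locales fact+
  have c2: "cost_rate c2" and c3: "cost_rate c3"
    using assms(10-16) by (auto simp: cost_rate_def)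
  have diff: "cost_rate (\<lambda>u. c2 u - c3 u)"
    \<comment> \<open>Nonnegativity of the difference is where \<open>c3 \<le> c2\<close>
      enters.\<close>
    using assms(10-16) by (auto simp: cost_rate_def left_diff_distrib intro!: set_integral_diff(1))
  have "integrable M (\<lambda>\<omega>. stieltjes_int T N \<omega> 0 (real T) (\<lambda>u. exp (- \<delta> * (u - real 0)) * c3 u))"
    using \<open>0 \<le> \<delta>\<close> by (intro integrable_stieltjes_int_discounted c3) auto
  then have int: "integrable M (discounted_c3 T N \<delta> c3)"
    by (simp add: discounted_c3_def[abs_def])
  have "0 \<le> discounted_c3 T N \<delta> c3 \<omega>" for \<omega>
    unfolding discounted_c3_def stieltjes_int_def set_lebesgue_integral_def
    using assms(10) by (intro integral_nonneg_AE AE_I2) (auto simp: indicator_def)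
  then have "0 \<le> A"
    unfolding A_def by (intro integral_nonneg_AE AE_I2)
  moreover have "tail_cost \<delta> c3 0 = A"
    by (simp add: tail_cost_def mean_discounted_def A_def discounted_c3_def)
  then have "V_star M T N \<delta> K cbar c1 c2 c3 c4 x
      = (INF (\<tau>, \<mu>)\<in>policies M T N. ereal (policy_cost M N \<delta> (ordering_cost K cbar)
          (reformulated_stage_cost M T N \<delta> c1 c2 c3) (\<lambda>_. reformulated_stopping_cost c4) x \<tau> \<mu>) + ereal A)"
    unfolding V_star_def optimal_cost_def
    by (intro INF_cong refl)
       (auto simp: policy_cost_shift[OF _ \<open>0 \<le> \<delta>\<close> c2 c3 diff])
  then have "V_star M T N \<delta> K cbar c1 c2 c3 c4 x = V_tilde_star M T N \<delta> K cbar c1 c2 c3 c4 x + ereal A"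
    unfolding V_tilde_star_def optimal_cost_def
    by (simp add: case_prod_unfold flip: INF_ereal_add_const)
  ultimately show ?thesis
    using int by simp
qed

end
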